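(* Let $l$, $n$ and $d\geqslant n$ be positive integers. Then every word over an ordered alphabet of cardinality $l$ whose length is not less than $\Psi(n,d,l)$ either contains a subword of the form $x^d$ with $x$ a nonempty word, or is $n$-divisible. Here $$\Psi(n,d,l)=4^{5+3\log_3 4}\, l\, (nd)^{3 \log_3 (nd)+(5+6\log_3 4)}\,d^2.$$
   Context: The alphabet $a_1\prec a_2\prec\dots\prec a_l$ is linearly ordered, and words are compared lexicographically; two words are incomparable if one of them is a beginning (prefix) of the other. Thus $u\succ v$ means that neither word is a prefix of the other and, at the first position where they differ, the letter of $u$ is greater than that of $v$. Subwords are blocks of consecutive letters. A word $W$ is $n$-divisible if it can be represented as a concatenation $W=vu_1u_2\cdots u_n$ with $u_1\succ u_2\succ\dots\succ u_n$. *)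

theory Defs
  imports Complex_Main "HOL-Library.Sublist"
begin

text \<open>
  Words are lists over a linearly ordered type of letters.  The library order \<^const>\<open>lexord\<close>
  puts a proper prefix below the longer word; here two words one of which is a prefix of
  the other are incomparable, so a strict comparison needs a first position where the words differ.
\<close>

definition word_greater :: "'a::linorder list \<Rightarrow> 'a list \<Rightarrow> bool" (infix \<open>\<succ>\<close> 50) where
  "u \<succ> v \<longleftrightarrow> (\<exists>p a b s t. u = p @ a # s \<and> v = p @ b # t \<and> a > b)"

lemma word_greater_Nil [simp]: "\<not> [] \<succ> v" "\<not> u \<succ> []"
  by (simp_all add: word_greater_def)

lemma word_greater_Cons [simp]:
  "x # xs \<succ> y # ys \<longleftrightarrow> x > y \<or> x = y \<and> xs \<succ> ys"
proof
  assume "x # xs \<succ> y # ys"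
  then obtain p a b s t where "x # xs = p @ a # s" "y # ys = p @ b # t" "b < a"
    unfolding word_greater_def by auto
  then show "x > y \<or> x = y \<and> xs \<succ> ys"
    by (cases p) (auto simp: word_greater_def)
next
  assume "x > y \<or> x = y \<and> xs \<succ> ys"
  then show "x # xs \<succ> y # ys"
  proof
    assume "x > y"
    then show ?thesis
      unfolding word_greater_def by (intro exI[of _ "[]"]) auto
  next
    assume *: "x = y \<and> xs \<succ> ys"
    then obtain p a b s t where "xs = p @ a # s" "ys = p @ b # t" "b < a"
      unfolding word_greater_def by auto
    with * show ?thesis
      unfolding word_greater_def by (intro exI[of _ "x # p"]) auto
  qed
qed

lemma transp_word_greater: "transp (\<succ>)"
proof (rule transpI)
  fix u v w :: "'a list"
  assume "u \<succ> v" and "v \<succ> w"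
  then show "u \<succ> w"
  proof (induction v arbitrary: u w)
    case Nil
    then show ?case by simp
  next
    case (Cons c v)
    from Cons.prems obtain x xs y ys where uw: "u = x # xs" "w = y # ys"
      by (metis list.exhaust word_greater_Nil)
    from Cons.prems Cons.IH[of xs ys] show ?case
      unfolding uw word_greater_Cons by (meson less_trans)
  qed
qed

text \<open>
  The prefix \<open>v\<close> may be empty.  For \<open>n \<ge> 2\<close> all \<open>u\<^sub>i\<close> are nonempty, since a
  comparison with the empty word never holds.
\<close>

definition n_divisible :: "nat \<Rightarrow> 'a::linorder list \<Rightarrow> bool" where
  "n_divisible n W \<longleftrightarrow>
     (\<exists>v us. length us = n \<and> W = v @ concat us \<and> sorted_wrt (\<succ>) us)"

definition word_power :: "'a list \<Rightarrow> nat \<Rightarrow> 'a list" where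
  "word_power x d = concat (replicate d x)"

definition \<Psi> :: "nat \<Rightarrow> nat \<Rightarrow> nat \<Rightarrow> real" where
  "\<Psi> n d l =
     4 powr (5 + 3 * log 3 4) * real l
     * (real n * real d) powr (3 * log 3 (real n * real d) + (5 + 6 * log 3 4))
     * (real d)\<^sup>2"

end

theory Submission
  imports Defs
begin

text \<open>
  Suppose \<open>W\<close> is not \<open>n\<close>-divisible and contains no \<open>d\<close>-th power, and put \<open>N = n * d\<close>.  Fix a
  depth \<open>D = 3 ^ k\<close> with \<open>N \<le> D \<le> 3 * N\<close> and look at the factors of length \<open>D\<close> of \<open>W\<close>.  Colour
  a position by the greatest number of blocks into which the suffix starting there can be divided
  in descending order, the first block beginning with the factor at that position.  There are
  fewer than \<open>n\<close> blocks, hence at most \<open>n\<close> colours, and a position followed at distance at least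
  \<open>D\<close> by one of the same colour has a factor that is not greater, for otherwise its colour would
  be larger (\<open>ex_colouring\<close>).  Positions of the same colour and the same residue modulo \<open>D\<close>, called
  similar, are automatically that far apart.  So within each of the at most \<open>D * n\<close> similarity
  classes the prefixes of length \<open>a \<le> D\<close> of the factors ascend from left to right.

  Call an interval of positions settled at level \<open>a\<close> if these prefixes of length \<open>a\<close> are
  constant on every class.  Settled intervals have bounded length, by descent from level \<open>D\<close>:

  \<^item> In an interval settled at level \<open>D\<close>, every class repeats one factor of length \<open>D\<close> without
    overlaps.  That can happen fewer than \<open>n\<close> times: among the first \<open>n\<close> suffixes of a word of
    length at least \<open>n * d\<close>, either two are incomparable, which makes a long suffix periodic and yields
    a \<open>d\<close>-th power, or all are comparable, and then one suffix from each occurrence, in descending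
    order, divides \<open>W\<close> (\<open>frequent_factor\<close>).

  \<^item> In an interval settled at level \<open>a\<close>, a prefix of length \<open>a\<close> is determined by its class, so a
    prefix of length \<open>3 * a\<close> is determined by the class of its position \<open>i\<close> and the colours of
    \<open>i + a\<close> and \<open>i + 2 * a\<close>.  Each class ascends, so the prefixes of length \<open>3 * a\<close> increase at most
    \<open>D * n * n\<^sup>2\<close> times in all, and between the increases the interval is settled at level \<open>3 * a\<close>
    (\<open>settled_triple_bound\<close>).

  The same count with single letters instead of pairs of colours cuts \<open>W\<close> itself into about
  \<open>D * n * l\<close> intervals settled at level \<open>1\<close>.  Since \<open>k\<close> triplings lead from \<open>1\<close> to \<open>D\<close>, the
  length of \<open>W\<close> is less than \<open>3 * D\<^sup>2 * n ^ 3 * l * (D * n ^ 3 + 3) ^ k\<close> (\<open>length_bound\<close>).  With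
  \<open>p = 4 * N\<close>, the bound \<open>n\<^sup>2 \<le> N\<close> (this is where \<open>n \<le> d\<close> enters) makes each tripling cost at most
  \<open>p ^ 3\<close>, and \<open>k \<le> log 3 p\<close>; as \<open>\<Psi> n d l\<close> equals \<open>l * p powr (5 + 3 * log 3 p) * d\<^sup>2\<close>, the word
  \<open>W\<close> is shorter than \<open>\<Psi> n d l\<close>.
\<close>

section \<open>Comparing words\<close>

lemma word_greater_irrefl: "\<not> u \<succ> u"
  by (induction u) auto

text \<open>
  The first difference already lies inside \<open>u\<close> and \<open>v\<close>, so lengthening them cannot change the
  outcome.  This is what allows blocks of a division to be compared by their beginnings.
\<close>

lemma word_greater_extend:
  assumes "u \<succ> v" "prefix u u'" "prefix v v'"
  shows "u' \<succ> v'"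
proof -
  obtain p a b s t where "u = p @ a # s" "v = p @ b # t" "a > b"
    using assms(1) unfolding word_greater_def by blast
  moreover obtain s' t' where "u' = u @ s'" "v' = v @ t'"
    using assms(2,3) by (auto elim!: prefixE)
  ultimately show ?thesis unfolding word_greater_def by fastforce
qed

lemma incomparable_imp_prefix:
  "\<not> u \<succ> v \<Longrightarrow> \<not> v \<succ> u \<Longrightarrow> prefix u v \<or> prefix v u"
proof (induction u arbitrary: v)
  case (Cons x u)
  then show ?case by (cases v) auto
qed simp

lemma word_greater_total:
  assumes "length u = length v" "u \<noteq> v"
  shows "u \<succ> v \<or> v \<succ> u"
  using incomparable_imp_prefix[of u v] assms
  by (metis append_eq_conv_conj prefix_def take_all_iff order_refl)

section \<open>Divisions read off from descending occurrences\<close>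

text \<open>
  Here \<open>u\<close> records a beginning of the first block.  A further block can be put in front as soon as
  it beats \<open>u\<close>, wherever the blocks end; this makes divisions constructible from right to left.
\<close>

definition division_at :: "'a::linorder list \<Rightarrow> nat \<Rightarrow> nat \<Rightarrow> 'a list \<Rightarrow> bool" where
  "division_at W k i u \<longleftrightarrow>
     (\<exists>us. us \<noteq> [] \<and> length us = k \<and> concat us = drop i W
           \<and> sorted_wrt (\<succ>) us \<and> prefix u (hd us))"

lemma division_at_single: "prefix u (drop i W) \<Longrightarrow> division_at W 1 i u"
  unfolding division_at_def by (intro exI[of _ "[drop i W]"]) simp

text \<open>
  The new block is everything from \<open>i\<close> up to \<open>j\<close>; because \<open>u\<close> fits into it, the comparison of \<open>u\<close>
  with \<open>v\<close> decides the comparison of the two blocks.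
\<close>

lemma division_at_step:
  assumes "division_at W k j v" "u \<succ> v" "prefix u (drop i W)" "i + length u \<le> j"
  shows "division_at W (Suc k) i u"
proof -
  obtain us where us: "us \<noteq> []" "length us = k" "concat us = drop j W"
      "sorted_wrt (\<succ>) us" "prefix v (hd us)"
    using assms(1) unfolding division_at_def by blast
  define b where "b = take (j - i) (drop i W)"
  have u_b: "prefix u b"
    using assms(3,4) unfolding b_def
    by (metis le_diff_conv2 add.commute add_leD1 prefix_def take_append append_take_drop_id
        take_all_iff)
  have b_hd: "b \<succ> hd us"
    using word_greater_extend[OF assms(2) u_b us(5)] .
  have "b \<succ> x" if "x \<in> set us" for x
    using that us(1,4) b_hd
    by (cases us) (auto dest: transpD[OF transp_word_greater])
  then have "sorted_wrt (\<succ>) (b # us)"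
    using us(4) by simp
  moreover have "concat (b # us) = drop i W"
    using us(3) assms(4) append_take_drop_id[of "j - i" "drop i W"]
    unfolding b_def by simp
  ultimately show ?thesis
    unfolding division_at_def using us(2) u_b by (intro exI[of _ "b # us"]) simp
qed

text \<open>
  Surplus blocks at the front are absorbed into the undivided beginning of \<open>W\<close>.
\<close>

lemma division_at_imp_n_divisible:
  assumes "division_at W k i u" "n \<le> k"
  shows "n_divisible n W"
proof -
  obtain us where us: "length us = k" "concat us = drop i W" "sorted_wrt (\<succ>) us"
    using assms(1) unfolding division_at_def by blast
  let ?v = "take i W @ concat (take (k - n) us)" and ?us = "drop (k - n) us"
  have "W = ?v @ concat ?us"
    using us(2) by (metis append.assoc append_take_drop_id concat_append)
  moreover have "sorted_wrt (\<succ>) ?us"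
    using us(3) by (metis append_take_drop_id sorted_wrt_append)
  moreover have "length ?us = n"
    using us(1) assms(2) by simp
  ultimately show ?thesis
    unfolding n_divisible_def by blast
qed

section \<open>Repeated factors\<close>

text \<open>
  A word that begins with its own shift by \<open>m\<close> has period \<open>m\<close>: the powers of its first \<open>m\<close> letters
  are peeled off one by one, since \<open>drop m v\<close> again begins with every short enough beginning of \<open>v\<close>.
\<close>

lemma power_prefix_of_period:
  assumes "prefix (drop m v) v" "m * k \<le> length v"
  shows "prefix (word_power (take m v) k) v"
  using assms(2)
proof (induction k)
  case (Suc k)
  let ?x = "take m v"
  have len: "length (word_power ?x k) = m * k"
    using Suc.prems by (simp add: word_power_def length_concat sum_list_replicate)
  have "prefix (word_power ?x k) (drop m v)"
    using prefix_length_prefix[OF Suc.IH assms(1)] Suc.prems len by simp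
  then have "prefix (?x @ word_power ?x k) v"
    by (metis append_take_drop_id same_prefix_prefix)
  then show ?case
    by (simp add: word_power_def)
qed (simp add: word_power_def)

lemma finite_sorted_wrt_ex:
  assumes "finite S" "transp R" "irreflp R"
    and "\<And>x y. x \<in> S \<Longrightarrow> y \<in> S \<Longrightarrow> x \<noteq> y \<Longrightarrow> R x y \<or> R y x"
  shows "\<exists>xs. set xs = S \<and> length xs = card S \<and> sorted_wrt R xs"
  using assms(1,4)
proof (induction S)
  case (insert x S)
  then obtain xs where xs: "set xs = S" "length xs = card S" "sorted_wrt R xs"
    by blast
  have compl: "R x y \<longleftrightarrow> \<not> R y x" if "y \<in> S" for y
    using insert.hyps(2) insert.prems[of x y] that assms(2,3)
    by (metis insertCI irreflpD transpD)
  let ?ys = "filter (\<lambda>y. R y x) xs @ x # filter (\<lambda>y. \<not> R y x) xs"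
  have "sorted_wrt R ?ys"
    using xs(1,3) compl by (auto simp: sorted_wrt_append sorted_wrt_filter intro: transpD[OF assms(2)])
  moreover have "set ?ys = insert x S"
    using xs(1) by auto
  moreover have "length ?ys = card (insert x S)"
    using insert.hyps xs(2) sum_length_filter_compl[of "\<lambda>y. R y x" xs] by simp
  ultimately show ?case by blast
qed simp

text \<open>
  Each occurrence of \<open>u\<close> in \<open>W\<close> contributes one suffix of \<open>u\<close>.  The occurrences do not overlap, so
  the suffixes can be chosen in any order, in particular in descending order.
\<close>

lemma division_at_of_occurrences:
  assumes "length os = length ps" "ps \<noteq> []"
    and "sorted_wrt (\<lambda>a b. drop a u \<succ> drop b u) os"
    and "sorted_wrt (\<lambda>i j. i + length u \<le> j) ps"
    and "\<And>i. i \<in> set ps \<Longrightarrow> prefix u (drop i W)"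
    and "\<And>a. a \<in> set os \<Longrightarrow> a \<le> length u"
  shows "division_at W (length ps) (hd ps + hd os) (drop (hd os) u)"
  using assms
proof (induction os ps rule: list_induct2)
  case (Cons a os i ps)
  have pre: "prefix (drop a u) (drop (i + a) W)"
  proof -
    have "prefix (drop a u) (drop a (drop i W))"
      using Cons.prems(4)[of i] Cons.prems(5)[of a] by (auto simp: prefix_def simp del: drop_drop)
    then show ?thesis by (simp add: add.commute)
  qed
  show ?case
  proof (cases "ps = []")
    case True
    then show ?thesis using division_at_single[OF pre] by simp
  next
    case False
    then have nonempty: "os \<noteq> []"
      using Cons.hyps by auto
    have "division_at W (length ps) (hd ps + hd os) (drop (hd os) u)"
      using Cons.IH[OF False] Cons.prems by simp
    moreover have "drop a u \<succ> drop (hd os) u" "i + length u \<le> hd ps"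
      using Cons.prems(2,3) False nonempty by simp_all
    ultimately show ?thesis
      using division_at_step[OF _ _ pre] Cons.prems(5)[of a] by simp
  qed
qed simp

text \<open>
  The first \<open>n\<close> suffixes of \<open>u\<close> are either pairwise comparable, and then distributing them over the
  \<open>n\<close> occurrences divides \<open>W\<close>; or one of them begins with a later one, less than \<open>n\<close> letters
  further right, and then it has a period so short that \<open>d\<close> repetitions fit into it.
\<close>

lemma frequent_factor:
  assumes "n > 0" "d > 0" "n * d \<le> length u"
    and "length ps = n" "sorted_wrt (\<lambda>i j. i + length u \<le> j) ps"
    and "\<And>i. i \<in> set ps \<Longrightarrow> prefix u (drop i W)"
  shows "(\<exists>x. x \<noteq> [] \<and> sublist (word_power x d) W) \<or> n_divisible n W"
proof (cases "\<exists>a b. a < b \<and> b < n \<and> \<not> drop a u \<succ> drop b u \<and> \<not> drop b u \<succ> drop a u")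
  case True
  then obtain a b where ab: "a < b" "b < n" "\<not> drop a u \<succ> drop b u" "\<not> drop b u \<succ> drop a u"
    by blast
  have "n \<le> n * d"
    using assms(2) by simp
  then have b_len: "b < length u"
    using ab(2) assms(3) by linarith
  let ?v = "drop a u" and ?m = "b - a"
  have "drop ?m ?v = drop b u"
    using ab(1) by simp
  moreover have "\<not> prefix (drop a u) (drop b u)"
    using ab(1) b_len by (auto dest: prefix_length_le)
  ultimately have period: "prefix (drop ?m ?v) ?v"
    using incomparable_imp_prefix[OF ab(3,4)] by simp
  (* With period m = b - a, the first d periods of v end within u: m*d + a <= b*d <= n*d. *)
  have "?m * d + a * 1 \<le> ?m * d + a * d"
    using assms(2) by (intro add_left_mono mult_left_mono) auto
  also have "\<dots> = b * d"
    using ab(1) by (simp flip: add_mult_distrib)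
  also have "\<dots> \<le> n * d"
    using ab(2) by simp
  finally have "?m * d \<le> length ?v"
    using assms(3) by simp
  then have "prefix (word_power (take ?m ?v) d) ?v"
    by (rule power_prefix_of_period[OF period])
  moreover have "sublist ?v W"
  proof -
    have "hd ps \<in> set ps"
      using assms(1,4) by auto
    then have "sublist u W"
      using assms(6) by (meson prefix_imp_sublist sublist_drop sublist_order.order_trans)
    then show ?thesis
      using sublist_drop sublist_order.order_trans by blast
  qed
  ultimately have "sublist (word_power (take ?m ?v) d) W"
    using prefix_imp_sublist sublist_order.order_trans by blast
  moreover have "take ?m ?v \<noteq> []"
    using ab(1) b_len by simp
  ultimately show ?thesis by blast
next
  case False
  let ?R = "\<lambda>a b. drop a u \<succ> drop b u"
  have "\<exists>os. set os = {..<n} \<and> length os = card {..<n} \<and> sorted_wrt ?R os"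
  proof (rule finite_sorted_wrt_ex)
    show "transp ?R"
      using transp_word_greater by (auto simp: transp_def)
    show "irreflp ?R"
      by (simp add: irreflp_def word_greater_irrefl)
    show "?R a b \<or> ?R b a" if "a \<in> {..<n}" "b \<in> {..<n}" "a \<noteq> b" for a b
      using False that by (metis lessThan_iff linorder_neqE_nat)
  qed simp
  then obtain os where os: "set os = {..<n}" "length os = n" "sorted_wrt ?R os"
    by auto
  have "n \<le> n * d"
    using assms(2) by simp
  then have "a \<le> length u" if "a \<in> set os" for a
    using that os(1) assms(3) by (metis lessThan_iff less_imp_le order_trans)
  then have "division_at W (length ps) (hd ps + hd os) (drop (hd os) u)"
    using assms(1,4-6) os(2,3) by (intro division_at_of_occurrences) auto
  then have "n_divisible n W"
    using assms(4) division_at_imp_n_divisible by blast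
  then show ?thesis ..
qed

section \<open>Intervals on which similar positions agree\<close>

abbreviation factor :: "'a list \<Rightarrow> nat \<Rightarrow> nat \<Rightarrow> 'a list" where
  "factor W i a \<equiv> take a (drop i W)"

locale coloured_word =
  fixes W :: "'a::linorder list" and D n :: nat and col :: "nat \<Rightarrow> nat"
  assumes D_pos: "D > 0"
    and col_less: "\<And>i. i + D \<le> length W \<Longrightarrow> col i < n"
    and col_ascending: "\<And>i j. i + D \<le> j \<Longrightarrow> j + D \<le> length W \<Longrightarrow> col i = col j
           \<Longrightarrow> \<not> factor W i D \<succ> factor W j D"
begin

definition similar :: "nat \<Rightarrow> nat \<Rightarrow> bool" where
  "similar i j \<longleftrightarrow> i mod D = j mod D \<and> col i = col j"

text \<open>
  The interval of positions is \<open>{s..<e}\<close>, but the factors compared may reach beyond \<open>e\<close>.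
  Below, \<open>e + D \<le> Suc (length W)\<close> says that a factor of full length \<open>D\<close> starts at each position
  before \<open>e\<close>.
\<close>

definition settled :: "nat \<Rightarrow> nat \<Rightarrow> nat \<Rightarrow> bool" where
  "settled a s e \<longleftrightarrow>
     (\<forall>i j. s \<le> i \<and> i < j \<and> j < e \<and> similar i j \<longrightarrow> factor W i a = factor W j a)"

lemma settledD:
  assumes "settled a s e" "s \<le> i" "i < e" "s \<le> j" "j < e" "similar i j"
  shows "factor W i a = factor W j a"
  using assms unfolding settled_def similar_def by (metis linorder_neqE_nat)

text \<open>
  Equal residues modulo \<open>D\<close> keep the two factors of length \<open>D\<close> disjoint, and a descent between
  shorter factors would already be a descent between those.
\<close>

lemma similar_ascending:
  assumes "i < j" "similar i j" "j + D \<le> length W" "a \<le> D"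
  shows "\<not> factor W i a \<succ> factor W j a"
proof
  assume *: "factor W i a \<succ> factor W j a"
  have "D dvd j - i"
    using assms(1,2) unfolding similar_def by (metis mod_eq_dvd_iff_nat less_imp_le)
  then have "i + D \<le> j"
    using assms(1) by (auto dest: dvd_imp_le)
  moreover have "prefix (factor W k a) (factor W k D)" for k
    using assms(4) by (metis min.absorb1 take_is_prefix take_take)
  then have "factor W i D \<succ> factor W j D"
    using word_greater_extend[OF *] by blast
  ultimately show False
    using col_ascending assms(2,3) unfolding similar_def by blast
qed

text \<open>
  The interval is cut into blocks of length \<open>L\<close>.  No block is settled, so each contains a strict
  increase of the factors of length \<open>a\<close> within some class.  As classes ascend, the factors reached
  by the increases of one class differ from block to block; hence class and key of the
  right end of the increase determine the block, and there are at most \<open>D * n * card G\<close> blocks.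
\<close>

lemma unsettled_blocks_bound:
  fixes key :: "nat \<Rightarrow> 'k"
  assumes "a \<le> D" "e + D \<le> Suc (length W)" "L > 0"
    and unsettled: "\<And>t. s \<le> t \<Longrightarrow> t + L \<le> e \<Longrightarrow> \<not> settled a t (t + L)"
    and key: "\<And>i j. s \<le> i \<Longrightarrow> i < e \<Longrightarrow> s \<le> j \<Longrightarrow> j < e \<Longrightarrow> similar i j \<Longrightarrow> key i = key j
                \<Longrightarrow> factor W i a = factor W j a"
    and G: "finite G" "\<And>i. s \<le> i \<Longrightarrow> i < e \<Longrightarrow> key i \<in> G"
  shows "e - s < (D * n * card G + 1) * L"
proof -
  define K where "K = (e - s) div L"
  have block: "s + b * L + L \<le> e" if "b < K" for b
  proof -
    have "Suc b * L \<le> K * L"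
      using that by (intro mult_right_mono) auto
    also have "\<dots> \<le> e - s"
      by (simp add: K_def)
    finally have "b * L + L \<le> e - s" by simp
    then show ?thesis using assms(3) by linarith
  qed
  have "\<exists>i j. s + b * L \<le> i \<and> i < j \<and> j < s + b * L + L \<and> similar i j
              \<and> factor W i a \<noteq> factor W j a" if "b < K" for b
    using unsettled[of "s + b * L"] block[OF that] unfolding settled_def by auto
  then obtain I J where IJ: "\<And>b. b < K \<Longrightarrow> s + b * L \<le> I b \<and> I b < J b \<and> J b < s + b * L + L
      \<and> similar (I b) (J b) \<and> factor W (I b) a \<noteq> factor W (J b) a"
    by metis
  have J_range: "s \<le> J b" "J b < e" if "b < K" for b
    using IJ[OF that] block[OF that] by linarith+
  (* I b and J b are the two ends of an increase in block b. *)
  let ?f = "\<lambda>b. (J b mod D, col (J b), key (J b))"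
  have differ: "?f b \<noteq> ?f c" if "b < c" "c < K" for b c
  proof
    assume eq: "?f b = ?f c"
    have "b < K" using that by simp
    have "Suc b * L \<le> c * L"
      using that(1) by (intro mult_right_mono) auto
    then have "J b < I c"
      using IJ[OF \<open>b < K\<close>] IJ[OF that(2)] by simp
    have sim: "similar (J b) (J c)"
      using eq by (simp add: similar_def)
    then have same: "factor W (J b) a = factor W (J c) a"
      using key J_range \<open>b < K\<close> that(2) eq by simp
    (* The factors at J b, I c, J c ascend and the outer two agree, so I c and J c agree as well. *)
    have "similar (J b) (I c)"
      using sim IJ[OF that(2)] by (simp add: similar_def)
    then have 1: "\<not> factor W (J b) a \<succ> factor W (I c) a"
      using similar_ascending[OF \<open>J b < I c\<close>] J_range(2)[OF that(2)] IJ[OF that(2)] assms(1,2)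
      by simp
    have 2: "\<not> factor W (I c) a \<succ> factor W (J c) a"
      using similar_ascending IJ[OF that(2)] J_range(2)[OF that(2)] assms(1,2) by simp
    have "I c + a \<le> length W" "J c + a \<le> length W"
      using IJ[OF that(2)] J_range(2)[OF that(2)] assms(1,2) by linarith+
    then have "length (factor W (I c) a) = length (factor W (J c) a)"
      by (simp only: length_take length_drop)
    then show False
      using word_greater_total 1 2 same IJ[OF that(2)] by metis
  qed
  have "inj_on ?f {..<K}"
    by (intro inj_onI) (metis differ lessThan_iff linorder_neqE_nat)
  moreover have "?f ` {..<K} \<subseteq> {..<D} \<times> {..<n} \<times> G"
    using D_pos J_range G(2) col_less assms(2) by fastforce
  ultimately have "card {..<K} \<le> card ({..<D} \<times> {..<n} \<times> G)"
    using G(1) by (intro card_inj_on_le) auto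
  then have "K \<le> D * n * card G"
    by (simp add: card_cartesian_product)
  have "e - s < Suc K * L"
    using assms(3) by (simp add: K_def dividend_less_div_times)
  also have "\<dots> \<le> (D * n * card G + 1) * L"
    using \<open>K \<le> D * n * card G\<close> by (intro mult_right_mono) auto
  finally show ?thesis .
qed

text \<open>
  A factor of length \<open>3 * a\<close> consists of three factors of length \<open>a\<close>, at positions whose residues are
  determined by that of the first.  In an interval settled at level \<open>a\<close> the three are therefore known
  once the class of the first position and the colours of the other two are.
\<close>

lemma settled_triple_bound:
  assumes "3 * a \<le> D" "L \<ge> D"
    and IH: "\<And>s e. e + D \<le> Suc (length W) \<Longrightarrow> settled (3 * a) s e \<Longrightarrow> e - s < L"
    and e: "e + D \<le> Suc (length W)" and settled: "settled a s e"
  shows "e - s < (D * n ^ 3 + 3) * L"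
proof -
  let ?key = "\<lambda>i. (col (i + a), col (i + 2 * a))" and ?G = "{..<n} \<times> {..<n}"
  (* All three positions must lie in the settled interval, so its last 2 * a positions are left out
     of the count; they are paid for by an extra 2 * L. *)
  have "(e - 2 * a) - s < (D * n * card ?G + 1) * L"
  proof (rule unsettled_blocks_bound[where key = ?key])
    show "0 < L" using assms(2) D_pos by simp
    show "\<not> settled (3 * a) t (t + L)" if "t + L \<le> e - 2 * a" for t
      using IH[of "t + L" t] that e by fastforce
    show "?key i \<in> ?G" if "i < e - 2 * a" for i
      using that e col_less by simp
    show "factor W i (3 * a) = factor W j (3 * a)"
      if ij: "s \<le> i" "i < e - 2 * a" "s \<le> j" "j < e - 2 * a" "similar i j" "?key i = ?key j" for i j
    proof -
      have mods: "(i + c) mod D = (j + c) mod D" for c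
        using ij(5) unfolding similar_def by (metis mod_add_cong)
      have "similar (i + a) (j + a)" "similar (i + 2 * a) (j + 2 * a)"
        using ij(6) mods by (simp_all add: similar_def)
      then have "factor W (i + a) a = factor W (j + a) a"
          "factor W (i + 2 * a) a = factor W (j + 2 * a) a" "factor W i a = factor W j a"
        using settledD[OF settled] ij by simp_all
      moreover have "factor W k (3 * a)
          = factor W k a @ factor W (k + a) a @ factor W (k + 2 * a) a" for k
      proof -
        have "3 * a = a + (a + a)" "k + a = a + k" "k + 2 * a = a + (a + k)"
          by simp_all
        then show ?thesis by (simp only: take_add drop_drop)
      qed
      ultimately show ?thesis by simp
    qed
  qed (use assms(1) e in auto)
  moreover have "D * n * card ?G = D * n ^ 3"
    by (simp add: card_cartesian_product power3_eq_cube)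
  ultimately have "(e - 2 * a) - s < D * n ^ 3 * L + L"
    by (simp only: add_mult_distrib mult_1)
  moreover have "2 * a \<le> 2 * L"
    using assms(1,2) by simp
  ultimately have "e - s < D * n ^ 3 * L + 3 * L"
    by linarith
  then show ?thesis
    by (simp only: add_mult_distrib)
qed

end

text \<open>
  Positions in \<open>S\<close> have the same residue, so \<open>u\<close> would be repeated there without overlaps.
  An infinite \<open>S\<close> cannot occur, as \<open>W\<close> is finite.
\<close>

locale sparse_coloured_word = coloured_word +
  assumes rare: "\<And>S u r. (\<And>i. i \<in> S \<Longrightarrow> i mod D = r \<and> i + D \<le> length W \<and> factor W i D = u)
                    \<Longrightarrow> card S < n"
begin

lemma n_pos: "n > 0"
  using rare[of "{}"] by simp

text \<open>
  Each of the \<open>D * n\<close> classes has fewer than \<open>n\<close> members in the interval, since all of them carry the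
  same factor of length \<open>D\<close>.
\<close>

lemma settled_depth_bound:
  assumes e: "e + D \<le> Suc (length W)" and settled: "settled D s e"
  shows "e - s < D * n ^ 2"
proof -
  let ?C = "{..<D} \<times> {..<n}"
  let ?F = "\<lambda>(r, c). {i \<in> {s..<e}. i mod D = r \<and> col i = c}"
  have "card (?F x) \<le> n - 1" for x
  proof -
    obtain r c where x: "x = (r, c)" by (cases x)
    have "card (?F x) < n"
    proof (cases "?F x = {}")
      case False
      then obtain i0 where i0: "i0 \<in> ?F x" by blast
      show ?thesis
      proof (rule rare[of _ r "factor W i0 D"])
        fix i assume "i \<in> ?F x"
        then show "i mod D = r \<and> i + D \<le> length W \<and> factor W i D = factor W i0 D"
          using i0 e settledD[OF settled, of i i0] unfolding x similar_def by auto
      qed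
    qed (use n_pos in simp)
    then show ?thesis by simp
  qed
  then have "(\<Sum>x\<in>?C. card (?F x)) \<le> card ?C * (n - 1)"
    using sum_bounded_above[of ?C "\<lambda>x. card (?F x)" "n - 1"] by simp
  moreover have "{s..<e} \<subseteq> (\<Union>x\<in>?C. ?F x)"
    using D_pos col_less e by fastforce
  then have "card {s..<e} \<le> card (\<Union>x\<in>?C. ?F x)"
    by (intro card_mono) auto
  moreover have "card (\<Union>x\<in>?C. ?F x) \<le> (\<Sum>x\<in>?C. card (?F x))"
    by (intro card_UN_le) simp
  ultimately have "e - s \<le> D * n * (n - 1)"
    by (simp add: card_cartesian_product)
  also have "\<dots> < D * n * n"
    using D_pos n_pos by simp
  finally show ?thesis by (simp add: power2_eq_square)
qed

lemma settled_power_bound: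
  assumes D: "D = a * 3 ^ k"
    and e: "e + D \<le> Suc (length W)" and settled: "settled a s e"
  shows "e - s < (D * n ^ 3 + 3) ^ k * (D * n ^ 2)"
  using D e settled
proof (induction k arbitrary: a s e)
  case 0
  then show ?case using settled_depth_bound by simp
next
  case (Suc k)
  let ?L = "(D * n ^ 3 + 3) ^ k * (D * n ^ 2)"
  have "e - s < (D * n ^ 3 + 3) * ?L"
  proof (rule settled_triple_bound)
    show "3 * a \<le> D" using Suc.prems(1) by simp
    have "1 * (D * 1) \<le> ?L"
      using n_pos by (intro mult_mono) auto
    then show "D \<le> ?L" by simp
    show "e - s < ?L" if "e + D \<le> Suc (length W)" "settled (3 * a) s e" for s e
      using Suc.IH[OF _ that] Suc.prems(1) by simp
  qed (use Suc.prems in auto)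
  then show ?case by (simp add: mult.assoc)
qed

text \<open>
  At level \<open>1\<close> the letter at a position serves as key, which brings in the size of the alphabet;
  the last \<open>D - 1\<close> positions, where no factor of length \<open>D\<close> starts, are added separately.
\<close>

lemma length_bound:
  assumes D: "D = 3 ^ k"
    and A: "finite A" "set W \<subseteq> A" "card A > 0"
  shows "length W < 3 * D ^ 2 * n ^ 3 * card A * (D * n ^ 3 + 3) ^ k"
proof -
  let ?L = "(D * n ^ 3 + 3) ^ k * (D * n ^ 2)"
  let ?e = "Suc (length W) - D"
  have "1 * (D * 1) \<le> ?L"
    using n_pos by (intro mult_mono) auto
  then have "D \<le> ?L" by simp
  have "length W < (D * n * card A + 2) * ?L"
  proof (cases "D \<le> length W")
    case True
    have "?e - 0 < (D * n * card A + 1) * ?L"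
    proof (rule unsettled_blocks_bound[where key = "\<lambda>i. W ! i" and a = 1])
      show "0 < ?L" using \<open>D \<le> ?L\<close> D_pos by linarith
      show "\<not> settled 1 t (t + ?L)" if "t + ?L \<le> ?e" for t
      proof
        assume "settled 1 t (t + ?L)"
        moreover have "t + ?L + D \<le> Suc (length W)"
          using that True by linarith
        moreover have "D = 1 * 3 ^ k"
          using D by simp
        ultimately have "t + ?L - t < ?L"
          using settled_power_bound by blast
        then show False by simp
      qed
      show "W ! i \<in> A" if "i < ?e" for i
        using that D_pos A(2) nth_mem[of i W] True by (simp add: subset_iff)
      show "factor W i 1 = factor W j 1" if "i < ?e" "j < ?e" "W ! i = W ! j" for i j
        using that D_pos by (auto simp: take_Suc_conv_app_nth)
    qed (use D_pos True A(1) in auto)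
    then have "length W < (D * n * card A + 1) * ?L + D"
      using True by linarith
    then show ?thesis
      using \<open>D \<le> ?L\<close> by (simp only: add_mult_distrib mult_1 mult_2)
  next
    case False
    then have "length W < ?L" using \<open>D \<le> ?L\<close> by linarith
    also have "\<dots> \<le> (D * n * card A + 2) * ?L" by simp
    finally show ?thesis .
  qed
  also have "\<dots> \<le> (3 * (D * n * card A)) * ?L"
  proof (intro mult_right_mono)
    have "0 < D * n * card A" using D_pos n_pos A(3) by simp
    then show "D * n * card A + 2 \<le> 3 * (D * n * card A)" by linarith
  qed simp
  also have "\<dots> = 3 * D ^ 2 * n ^ 3 * card A * (D * n ^ 3 + 3) ^ k"
    by (simp add: power2_eq_square power3_eq_cube)
  finally show ?thesis .
qed

end

section \<open>Colouring an indivisible word\<close>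

text \<open>
  The colour of \<open>i\<close> is the maximal number of blocks in a division of the suffix at \<open>i\<close> whose first
  block begins with the factor at \<open>i\<close>.  If the factor at \<open>i\<close> beats the one at \<open>j\<close>, a best
  division at \<open>j\<close> extends to \<open>i\<close> by one block, so the two colours differ.
\<close>

lemma ex_colouring:
  assumes "\<not> n_divisible n W" "D > 0"
  shows "\<exists>col. coloured_word W D n col"
proof -
  let ?K = "\<lambda>i. {k. division_at W k i (factor W i D)}"
  let ?col = "\<lambda>i. Max (?K i)"
  have bounded: "?K i \<subseteq> {..<n}" for i
    using division_at_imp_n_divisible assms(1) by (force simp: not_less[symmetric])
  then have fin: "finite (?K i)" for i
    using finite_subset by blast
  have "1 \<in> ?K i" for i
    by (intro CollectI division_at_single take_is_prefix)
  then have mem: "?col i \<in> ?K i" for i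
    using fin Max_in by blast
  have "coloured_word W D n ?col"
  proof
    show "?col i < n" for i
      using mem bounded by blast
    show "\<not> factor W i D \<succ> factor W j D"
      if "i + D \<le> j" "j + D \<le> length W" "?col i = ?col j" for i j
    proof
      assume "factor W i D \<succ> factor W j D"
      moreover have "i + length (factor W i D) \<le> j"
        using that(1,2) by simp
      ultimately have "Suc (?col j) \<in> ?K i"
        using division_at_step[OF _ _ take_is_prefix] mem[of j] by blast
      then have "Suc (?col j) \<le> ?col i"
        using fin by (intro Max_ge)
      then show False using that(3) by simp
    qed
  qed (rule assms(2))
  then show ?thesis by blast
qed

lemma repeated_factor_rare:
  assumes "n > 0" "d > 0" "n * d \<le> D"
    and "\<not> n_divisible n W" "\<nexists>x. x \<noteq> [] \<and> sublist (word_power x d) W"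
    and S: "\<And>i. i \<in> S \<Longrightarrow> i mod D = r \<and> i + D \<le> length W \<and> factor W i D = u"
  shows "card S < n"
proof (rule ccontr)
  assume "\<not> card S < n"
  then obtain T where T: "T \<subseteq> S" "card T = n" "finite T"
    by (metis obtain_subset_with_card_n not_less)
  then obtain i0 where "i0 \<in> S"
    using assms(1) by fastforce
  then have len: "length u = D"
    using S by fastforce
  let ?ps = "sorted_list_of_set T"
  have gap: "i + D \<le> j" if "i \<in> S" "j \<in> S" "i < j" for i j
  proof -
    have "D dvd j - i"
      using that S by (metis mod_eq_dvd_iff_nat less_imp_le)
    then show ?thesis
      using that(3) by (auto dest: dvd_imp_le)
  qed
  have "sorted_wrt (\<lambda>i j. i + length u \<le> j) ?ps"
  proof (rule sorted_wrt_mono_rel)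
    show "sorted_wrt (<) ?ps"
      by (rule strict_sorted_list_of_set)
    show "i + length u \<le> j" if "i \<in> set ?ps" "j \<in> set ?ps" "i < j" for i j
      using that T(1,3) gap len by auto
  qed
  moreover have "prefix u (drop i W)" if "i \<in> set ?ps" for i
    using that T(1,3) S[of i] take_is_prefix[of D "drop i W"] by auto
  ultimately show False
    using frequent_factor[of n d u ?ps W] assms(1-5) len T(2,3) by auto
qed

section \<open>Numerical estimate\<close>

text \<open>
  With \<open>p = 4 * N\<close> the exponent \<open>3 * log 3 p\<close> splits into \<open>3 * log 3 4\<close> and \<open>3 * log 3 N\<close>; the two
  mixed terms agree because \<open>4 powr log 3 N = N powr log 3 4\<close>, which accounts for the \<open>6 * log 3 4\<close>.
\<close>

lemma \<Psi>_eq: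
  assumes "n > 0" "d > 0"
  shows "\<Psi> n d l = real l * (4 * (real n * real d)) powr (5 + 3 * log 3 (4 * (real n * real d)))
           * (real d)\<^sup>2"
proof -
  define N where "N = real n * real d"
  have "N > 0" using assms by (simp add: N_def)
  have "(4::real) powr (5 + 3 * log 3 4) * N powr (3 * log 3 N + (5 + 6 * log 3 4))
        = (4 * N) powr (5 + 3 * log 3 (4 * N))"
    using \<open>N > 0\<close>
    by (simp add: powr_def log_def ln_mult exp_add[symmetric] field_simps)
  then show ?thesis
    unfolding \<Psi>_def N_def[symmetric] by (simp add: mult_ac)
qed

theorem theorem10:
  fixes l n d :: nat and A :: "'a::linorder set" and W :: "'a list"
  assumes "l > 0" and "n > 0" and "d > 0" and "d \<ge> n"
    and "finite A" and "card A = l"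
    and "set W \<subseteq> A"
    and "real (length W) \<ge> \<Psi> n d l"
  shows "(\<exists>x. x \<noteq> [] \<and> sublist (word_power x d) W) \<or> n_divisible n W"
proof (rule ccontr)
  assume neg: "\<not> ?thesis"
  define N where "N = n * d"
  define p where "p = 4 * (real n * real d)"
  have "N \<ge> 1" using assms(2,3) by (simp add: N_def)
  have p_N: "p = 4 * real N" by (simp add: p_def N_def)
  then have "p \<ge> 4" using \<open>N \<ge> 1\<close> by simp
  obtain m where m: "3 ^ m \<le> N" "N < 3 ^ (m + 1)"
    using ex_power_ivl1[of 3 N] \<open>N \<ge> 1\<close> by auto
  define k where "k = m + 1"
  define D :: nat where "D = 3 ^ k"
  have D: "N \<le> D" "D \<le> 3 * N"
    using m by (simp_all add: D_def k_def)
  then have "D > 0" using \<open>N \<ge> 1\<close> by simp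
  obtain col where "coloured_word W D n col"
    using ex_colouring neg \<open>D > 0\<close> by blast
  then interpret coloured_word W D n col .
  interpret sparse_coloured_word W D n col
  proof
    show "card S < n"
      if "\<And>i. i \<in> S \<Longrightarrow> i mod D = r \<and> i + D \<le> length W \<and> factor W i D = u" for S u r
      using repeated_factor_rare[of n d D W S r u] assms(2,3) D(1) neg that
      unfolding N_def by blast
  qed
  have "length W < 3 * D ^ 2 * n ^ 3 * l * (D * n ^ 3 + 3) ^ k"
    using length_bound[OF D_def assms(5,7)] assms(1,6) by simp
  also have "\<dots> \<le> (27 * N ^ 4) * l * (6 * N ^ 3) ^ k"
  proof -
    have "n \<le> N" using assms(3) by (simp add: N_def)
    have "n ^ 2 \<le> N" using assms(4) by (simp add: N_def power2_eq_square)
    then have "n ^ 3 \<le> N * N"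
      using mult_mono[OF \<open>n ^ 2 \<le> N\<close> \<open>n \<le> N\<close>] by (simp add: power2_eq_square power3_eq_cube)
    have Dn: "D * n ^ 3 \<le> (3 * N) * (N * N)"
      using D(2) \<open>n ^ 3 \<le> N * N\<close> by (intro mult_mono) auto
    have "D * (D * n ^ 3) \<le> (3 * N) * ((3 * N) * (N * N))"
      using mult_mono[OF D(2) Dn] by simp
    then have 1: "3 * D ^ 2 * n ^ 3 \<le> 27 * N ^ 4"
      by (simp add: power2_eq_square power4_eq_xxxx mult_ac)
    have cube: "3 * N * (N * N) = 3 * N ^ 3" by (simp add: power3_eq_cube)
    have 2: "D * n ^ 3 + 3 \<le> 6 * N ^ 3"
      using Dn by (simp only: cube) (use one_le_power[OF \<open>N \<ge> 1\<close>, of 3] in linarith)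
    show ?thesis
      by (rule mult_mono[OF mult_right_mono[OF 1] power_mono[OF 2]]) simp_all
  qed
  finally have "real (length W) < (27 * real N ^ 4) * real l * (6 * real N ^ 3) ^ k"
    by (metis (no_types, lifting) of_nat_less_iff of_nat_mult of_nat_numeral of_nat_power)
  also have "\<dots> \<le> p ^ 5 * real l * (p ^ 3) ^ k"
  proof -
    have "27 * real N ^ 4 \<le> p ^ 4"
      by (simp add: p_N power_mult_distrib)
    also have "\<dots> \<le> p ^ 5"
      using \<open>p \<ge> 4\<close> by (intro power_increasing) auto
    finally have "27 * real N ^ 4 \<le> p ^ 5" .
    moreover have "6 * real N ^ 3 \<le> p ^ 3"
      by (simp add: p_N power_mult_distrib)
    ultimately show ?thesis
      using \<open>p \<ge> 4\<close> by (intro mult_mono power_mono) auto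
  qed
  also have "\<dots> \<le> real l * p powr (5 + 3 * log 3 p) * (real d)\<^sup>2"
  proof -
    have "real (3 ^ k) \<le> real (3 * N)"
      using D(2) unfolding D_def by (simp only: of_nat_le_iff)
    then have "3 ^ k \<le> p" using \<open>N \<ge> 1\<close> by (simp add: p_N)
    then have "real k \<le> log 3 p"
      using le_log_iff[of 3 p "real k"] \<open>p \<ge> 4\<close> by (simp add: powr_realpow)
    then have "p powr (5 + 3 * real k) \<le> p powr (5 + 3 * log 3 p)"
      using \<open>p \<ge> 4\<close> by (intro powr_mono) auto
    moreover have "p powr (5 + 3 * real k) = p ^ 5 * (p ^ 3) ^ k"
    proof -
      have "p powr (5 + 3 * real k) = p powr real (5 + 3 * k)"
        by simp
      also have "\<dots> = p ^ (5 + 3 * k)"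
        using \<open>p \<ge> 4\<close> by (intro powr_realpow) auto
      also have "\<dots> = p ^ 5 * (p ^ 3) ^ k"
        by (simp only: power_add power_mult)
      finally show ?thesis .
    qed
    ultimately have "real l * (p ^ 5 * (p ^ 3) ^ k) * 1 \<le> real l * p powr (5 + 3 * log 3 p) * (real d)\<^sup>2"
      using assms(3) \<open>p \<ge> 4\<close> by (intro mult_mono) auto
    then show ?thesis by (simp add: mult_ac)
  qed
  also have "\<dots> = \<Psi> n d l"
    unfolding p_def using \<Psi>_eq[OF assms(2,3)] by simp
  finally show False using assms(8) by simp
qed

end
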